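(* Let $m<n$, $\mathbf{y}\in\mathbb{R}^m$, $\lambda>0$. Let $\mathbf{A}\in\mathbb{R}^{n\times n}$ be the matrix of a periodic two-dimensional convolution, let $\mathbf{M}\in\{0,1\}^{m\times n}$ be a masking matrix (its rows are a subset of the rows of the $n\times n$ identity matrix), and let $\mathbf{P}\in\mathbb{R}^{q\times n}$ ($q\ge n$) be the analysis operator of a Parseval frame, i.e. $\mathbf{P}^*\mathbf{P}=\mathbf{I}$. Then, for any $\mu_1,\mu_2>0$ and any initialization, the sequence $(\mathbf{z}_k)$ generated by Algorithm FA-MD (described in the context) converges to a solution of $$\min_{\mathbf{x}\in\mathbb{R}^n}\ \frac12\|\mathbf{y}-\mathbf{M}\mathbf{A}\mathbf{x}\|_2^2+\lambda\|\mathbf{P}\mathbf{x}\|_1.$$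
   Context: $(\cdot)^*$ denotes transpose and $\mathbf{I}$ the identity. Elements of $\mathbb{R}^n$ are images on an $N_1\times N_2$ grid, $n=N_1N_2$, in lexicographic order. "Periodic convolution" means $(\mathbf{A}\mathbf{x})(r)=\sum_s h(r-s)\mathbf{x}(s)$ for some real kernel $h$, with pixel indices taken modulo $(N_1,N_2)$; equivalently $\mathbf{A}$ is block-circulant with circulant blocks and is diagonalized by the 2D discrete Fourier transform. The soft-threshold function is $\mathrm{soft}(\mathbf{v},\gamma)=\mathrm{sign}(\mathbf{v})\odot\max\{|\mathbf{v}|-\gamma,0\}$, with sign, max and absolute value applied componentwise and $\odot$ the componentwise product. Algorithm FA-MD (frame analysis mask decoupling): choose $\mu_1,\mu_2>0$, $\mathbf{u}^{(1)}_0,\mathbf{d}^{(1)}_0\in\mathbb{R}^n$ and $\mathbf{u}^{(2)}_0,\mathbf{d}^{(2)}_0\in\mathbb{R}^q$ arbitrary. For $k=0,1,2,\dots$ (run without stopping) set $\boldsymbol{\zeta}^{(j)}=\mathbf{u}^{(j)}_k+\mathbf{d}^{(j)}_k$ ($j=1,2$) and $$\mathbf{z}_{k+1}=\Bigl(\mathbf{A}^*\mathbf{A}+\tfrac{\mu_2}{\mu_1}\mathbf{I}\Bigr)^{-1}\Bigl(\mathbf{A}^*\boldsymbol{\zeta}^{(1)}+\tfrac{\mu_2}{\mu_1}\mathbf{P}^*\boldsymbol{\zeta}^{(2)}\Bigr),$$ $$\mathbf{u}^{(1)}_{k+1}=(\mathbf{M}^*\mathbf{M}+\mu_1\mathbf{I})^{-1}\bigl(\mathbf{M}^*\mathbf{y}+\mu_1(\mathbf{A}\mathbf{z}_{k+1}-\mathbf{d}^{(1)}_k)\bigr),\qquad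 \mathbf{d}^{(1)}_{k+1}=\mathbf{d}^{(1)}_k-(\mathbf{A}\mathbf{z}_{k+1}-\mathbf{u}^{(1)}_{k+1}),$$ $$\mathbf{u}^{(2)}_{k+1}=\mathrm{soft}\bigl(\mathbf{P}\mathbf{z}_{k+1}-\mathbf{d}^{(2)}_k,\lambda/\mu_2\bigr),\qquad \mathbf{d}^{(2)}_{k+1}=\mathbf{d}^{(2)}_k-(\mathbf{P}\mathbf{z}_{k+1}-\mathbf{u}^{(2)}_{k+1}).$$ *)

theory Defs
  imports "HOL-Analysis.Analysis"
begin

text \<open>
  Images on an \<open>N1\<close> by \<open>N2\<close> grid are vectors in \<open>real ^ 'n\<close>, where a bijection
  \<open>pix :: 'n \<Rightarrow> nat \<times> nat\<close> onto \<open>{..<N1} \<times> {..<N2}\<close> assigns to every coordinate its pixel.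
  The index type \<open>'n\<close> carries no order, so the lexicographic arrangement of the pixels
  is merely one choice of \<open>pix\<close>.
\<close>

definition periodic_convolution ::
  "nat \<Rightarrow> nat \<Rightarrow> ('n::finite \<Rightarrow> nat \<times> nat) \<Rightarrow> real ^ 'n ^ 'n \<Rightarrow> bool" where
  "periodic_convolution N1 N2 pix A \<longleftrightarrow>
     (\<exists>h :: int \<Rightarrow> int \<Rightarrow> real. \<forall>(x :: real ^ 'n) (r :: 'n).
        (A *v x) $ r =
          (\<Sum>s\<in>UNIV. h ((int (fst (pix r)) - int (fst (pix s))) mod int N1)
                        ((int (snd (pix r)) - int (snd (pix s))) mod int N2) * x $ s))"

text \<open>Injectivity of \<open>\<lambda>i. row i M\<close> says that no row of the identity is selected twice.\<close>

definition masking_matrix :: "real ^ 'n::finite ^ 'm::finite \<Rightarrow> bool" where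
  "masking_matrix M \<longleftrightarrow>
     rows M \<subseteq> rows (mat 1 :: real ^ 'n ^ 'n) \<and> inj (\<lambda>i. row i M)"

definition parseval_analysis :: "real ^ 'n::finite ^ 'q::finite \<Rightarrow> bool" where
  "parseval_analysis P \<longleftrightarrow> transpose P ** P = mat 1"

definition l1_norm :: "real ^ 'q::finite \<Rightarrow> real" where
  "l1_norm v = (\<Sum>i\<in>UNIV. \<bar>v $ i\<bar>)"

definition soft :: "real ^ 'q::finite \<Rightarrow> real \<Rightarrow> real ^ 'q" where
  "soft v \<gamma> = (\<chi> i. sgn (v $ i) * max (\<bar>v $ i\<bar> - \<gamma>) 0)"

definition analysis_objective ::
  "real ^ 'n::finite ^ 'n \<Rightarrow> real ^ 'n ^ 'm::finite \<Rightarrow> real ^ 'n ^ 'q::finite \<Rightarrow> real ^ 'm \<Rightarrow> real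
    \<Rightarrow> real ^ 'n \<Rightarrow> real" where
  "analysis_objective A M P y lam x =
     1 / 2 * (norm (y - (M ** A) *v x))\<^sup>2 + lam * l1_norm (P *v x)"

text \<open>
  The initial values \<open>u1 0\<close>, \<open>d1 0\<close>, \<open>u2 0\<close>, \<open>d2 0\<close> are unconstrained and determine all
  iterates; the algorithm produces \<open>z k\<close> for \<open>k \<ge> 1\<close> only, so \<open>z 0\<close> is an irrelevant
  dummy value.
\<close>

definition fa_md_iterates ::
  "real ^ 'n::finite ^ 'n \<Rightarrow> real ^ 'n ^ 'm::finite \<Rightarrow> real ^ 'n ^ 'q::finite \<Rightarrow> real ^ 'm
    \<Rightarrow> real \<Rightarrow> real \<Rightarrow> real
    \<Rightarrow> (nat \<Rightarrow> real ^ 'n) \<Rightarrow> (nat \<Rightarrow> real ^ 'n) \<Rightarrow> (nat \<Rightarrow> real ^ 'n)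
    \<Rightarrow> (nat \<Rightarrow> real ^ 'q) \<Rightarrow> (nat \<Rightarrow> real ^ 'q) \<Rightarrow> bool" where
  "fa_md_iterates A M P y lam \<mu>1 \<mu>2 z u1 d1 u2 d2 \<longleftrightarrow>
     (\<forall>k.
        z (Suc k) =
          matrix_inv (transpose A ** A + (\<mu>2 / \<mu>1) *\<^sub>R mat 1) *v
            (transpose A *v (u1 k + d1 k) + (\<mu>2 / \<mu>1) *\<^sub>R (transpose P *v (u2 k + d2 k))) \<and>
        u1 (Suc k) =
          matrix_inv (transpose M ** M + \<mu>1 *\<^sub>R mat 1) *v
            (transpose M *v y + \<mu>1 *\<^sub>R (A *v z (Suc k) - d1 k)) \<and>
        d1 (Suc k) = d1 k - (A *v z (Suc k) - u1 (Suc k)) \<and>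
        u2 (Suc k) = soft (P *v z (Suc k) - d2 k) (lam / \<mu>2) \<and>
        d2 (Suc k) = d2 k - (P *v z (Suc k) - u2 (Suc k)))"

end

theory Submission
  imports Defs
begin

text \<open>
  With \<open>x\<^sub>k = (A z\<^sub>k\<^sub>+\<^sub>1 - d1\<^sub>k, P z\<^sub>k\<^sub>+\<^sub>1 - d2\<^sub>k)\<close> the algorithm is a Douglas--Rachford iteration
  \<open>x\<^sub>k\<^sub>+\<^sub>1 = T x\<^sub>k\<close>: the updates of \<open>u1\<close> and \<open>u2\<close> are proximal maps, and the update of \<open>z\<close> is the
  orthogonal projection onto the range of \<open>w \<mapsto> (A w, P w)\<close> for the inner product weighted by
  \<open>(\<mu>1, \<mu>2)\<close>. Every step lowers the squared distance to any fixed point by at least the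
  squared step length, so in finite dimension the iterates converge as soon as \<open>T\<close> has a fixed point.
  Fixed points correspond to points satisfying the first-order optimality conditions, i.e. to
  minimizers. A minimizer exists because \<open>\<parallel>x\<parallel> = \<parallel>P x\<parallel> \<le> \<parallel>P x\<parallel>\<^sub>1\<close> makes the objective coercive.
\<close>

section \<open>Fejer monotone iterations\<close>

text \<open>The decrements of \<open>\<Phi> (x k - p)\<close> tend to 0, so the residuals
  \<open>x (Suc k) - x k\<close> vanish, and coercivity keeps the orbit bounded. By continuity a
  cluster point is a fixed point; the monotone distance to it tends to 0 along a subsequence, hence
  along the whole sequence.\<close>

lemma fejer_iteration_converges:
  fixes x :: "nat \<Rightarrow> 'a::euclidean_space" and T :: "'a \<Rightarrow> 'a" and \<Phi> :: "'a \<Rightarrow> real"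
  assumes step: "\<And>k. x (Suc k) = T (x k)"
    and contT: "continuous_on UNIV T" and cont\<Phi>: "continuous_on UNIV \<Phi>"
    and zero: "\<Phi> 0 = 0" and c: "c > 0" and coercive: "\<And>v. c * (norm v)\<^sup>2 \<le> \<Phi> v"
    and fejer: "\<And>p v. T p = p \<Longrightarrow> \<Phi> (T v - p) \<le> \<Phi> (v - p) - \<Phi> (T v - v)"
    and fixed: "T p = p"
  obtains l where "T l = l" and "x \<longlonglongrightarrow> l"
proof -
  have nonneg: "\<Phi> v \<ge> 0" for v
    using coercive[of v] c by (smt (verit) mult_nonneg_nonneg zero_le_power2)
  have small: "w \<longlonglongrightarrow> 0" if "(\<lambda>k. \<Phi> (w k)) \<longlonglongrightarrow> 0" for w :: "nat \<Rightarrow> 'a"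
  proof -
    have "(\<lambda>k. (norm (w k))\<^sup>2) \<longlonglongrightarrow> 0"
    proof (rule tendsto_sandwich[OF _ _ tendsto_const])
      show "(\<lambda>k. \<Phi> (w k) / c) \<longlonglongrightarrow> 0"
        using tendsto_divide[OF that tendsto_const[of c]] c by simp
    qed (use coercive c in \<open>auto simp: field_simps\<close>)
    then have "(\<lambda>k. sqrt ((norm (w k))\<^sup>2)) \<longlonglongrightarrow> sqrt 0"
      by (rule tendsto_real_sqrt)
    then show ?thesis
      by (simp add: tendsto_norm_zero_iff)
  qed
  have dec: "decseq (\<lambda>k. \<Phi> (x k - q))" if "T q = q" for q
    using fejer[OF that] nonneg by (intro decseq_SucI) (smt (verit) step)
  have conv: "convergent (\<lambda>k. \<Phi> (x k - q))" if "T q = q" for q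
    using decseq_convergent[OF dec[OF that]] nonneg unfolding convergent_def by metis
  have res: "(\<lambda>k. x (Suc k) - x k) \<longlonglongrightarrow> 0"
  proof (rule small)
    obtain L where L: "(\<lambda>k. \<Phi> (x k - p)) \<longlonglongrightarrow> L"
      using conv[OF fixed] by (auto simp: convergent_def)
    have "(\<lambda>k. \<Phi> (x k - p) - \<Phi> (x (Suc k) - p)) \<longlonglongrightarrow> L - L"
      by (intro tendsto_diff L LIMSEQ_Suc)
    then have drop: "(\<lambda>k. \<Phi> (x k - p) - \<Phi> (x (Suc k) - p)) \<longlonglongrightarrow> 0"
      by simp
    show "(\<lambda>k. \<Phi> (x (Suc k) - x k)) \<longlonglongrightarrow> 0"
    proof (rule tendsto_sandwich[OF _ _ tendsto_const drop])
      show "\<forall>\<^sub>F k in sequentially. \<Phi> (x (Suc k) - x k) \<le> \<Phi> (x k - p) - \<Phi> (x (Suc k) - p)"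
        using fejer[OF fixed] by (intro always_eventually allI) (smt (verit) step)
    qed (simp add: nonneg)
  qed
  have "norm (x k - p) \<le> sqrt (\<Phi> (x 0 - p) / c)" for k
  proof (rule real_le_rsqrt)
    have "c * (norm (x k - p))\<^sup>2 \<le> \<Phi> (x 0 - p)"
      using coercive[of "x k - p"] decseqD[OF dec[OF fixed], of 0 k] by simp
    then show "(norm (x k - p))\<^sup>2 \<le> \<Phi> (x 0 - p) / c"
      using c by (simp add: field_simps)
  qed
  then have "bounded (range x)"
    by (intro boundedI[where B = "sqrt (\<Phi> (x 0 - p) / c) + norm p"])
      (smt (verit) imageE norm_triangle_sub)
  then obtain l r where r: "strict_mono r" and l: "(x \<circ> r) \<longlonglongrightarrow> l"
    using bounded_imp_convergent_subsequence by blast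
  have "(\<lambda>k. T (x (r k))) \<longlonglongrightarrow> T l"
    using continuous_on_tendsto_compose[OF contT l] by (simp add: o_def)
  \<comment> \<open>\<open>T (x (r k))\<close> is the successor of \<open>x (r k)\<close> in the
    full sequence, and consecutive terms merge.\<close>
  moreover have "(\<lambda>k. T (x (r k))) \<longlonglongrightarrow> 0 + l"
  proof -
    have "(\<lambda>k. (x (Suc (r k)) - x (r k)) + x (r k)) \<longlonglongrightarrow> 0 + l"
      using LIMSEQ_subseq_LIMSEQ[OF res r] l by (intro tendsto_add) (simp_all add: o_def)
    then show ?thesis by (simp add: step)
  qed
  ultimately have fixl: "T l = l"
    using LIMSEQ_unique by fastforce
  \<comment> \<open>Fejer monotonicity is now applied with the cluster point \<open>l\<close> itself
    as the fixed point.\<close>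
  obtain L where L: "(\<lambda>k. \<Phi> (x k - l)) \<longlonglongrightarrow> L"
    using conv[OF fixl] by (auto simp: convergent_def)
  have "(\<lambda>k. \<Phi> (x (r k) - l)) \<longlonglongrightarrow> \<Phi> (l - l)"
    using l by (intro continuous_on_tendsto_compose[OF cont\<Phi>] tendsto_intros) (auto simp: o_def)
  with LIMSEQ_subseq_LIMSEQ[OF L r] have "L = 0"
    using LIMSEQ_unique zero by (fastforce simp: o_def)
  with L have "(\<lambda>k. x k - l) \<longlonglongrightarrow> 0"
    by (intro small) simp
  then have "x \<longlonglongrightarrow> l"
    by (simp add: LIM_zero_iff)
  with fixl show ?thesis by (rule that)
qed

section \<open>Regularized normal equations\<close>

text \<open>This rule would rewrite \<open>transpose B *v a\<close> to \<open>a v* B\<close>, away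
  from the form in which the adjoint identities below are stated.\<close>

declare transpose_matrix_vector [simp del]

lemma matrix_inv_mult:
  assumes "invertible K"
  shows "K ** matrix_inv K = mat 1" and "matrix_inv K ** K = mat 1"
  using someI_ex[OF assms[unfolded invertible_def]] by (simp_all add: matrix_inv_def)

lemma inner_transpose_mult: "(transpose B *v a) \<bullet> b = a \<bullet> (B *v (b :: real ^ 'n))"
  by (metis dot_lmul_matrix inner_commute vector_transpose_matrix transpose_transpose)

lemma gram_shift_mult:
  "(transpose B ** B + c *\<^sub>R mat 1) *v w = transpose B *v (B *v w) + c *\<^sub>R (w :: real ^ 'n)"
  by (simp add: matrix_vector_mult_add_rdistrib matrix_vector_mul_assoc scaleR_matrix_vector_assoc [symmetric])

text \<open>Pairing a kernel vector \<open>w\<close> with its image gives a sum of squares in which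
  \<open>c * (norm w)\<^sup>2\<close> must vanish.\<close>

lemma invertible_gram_shift:
  fixes B :: "real ^ 'n ^ 'm"
  assumes "c > 0"
  shows "invertible (transpose B ** B + c *\<^sub>R mat 1)"
proof -
  have "w = 0" if "(transpose B ** B + c *\<^sub>R mat 1) *v w = 0" for w
  proof -
    have "0 = (transpose B *v (B *v w) + c *\<^sub>R w) \<bullet> w"
      using that by (simp add: gram_shift_mult)
    also have "\<dots> = (norm (B *v w))\<^sup>2 + c * (norm w)\<^sup>2"
      by (simp add: inner_add_left inner_transpose_mult power2_norm_eq_inner)
    finally show ?thesis
      using assms by (smt (verit) mult_pos_pos zero_le_power2 zero_less_norm_iff zero_less_power)
  qed
  then show ?thesis
    by (simp add: invertible_left_inverse matrix_left_invertible_ker)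
qed

text \<open>Trades the inverses in the algorithm for normal equations, which carry all later
  arguments.\<close>

lemma matrix_inv_gram_shift_iff:
  fixes B :: "real ^ 'n ^ 'm"
  assumes "c > 0"
  shows "matrix_inv (transpose B ** B + c *\<^sub>R mat 1) *v b = w
    \<longleftrightarrow> transpose B *v (B *v w) + c *\<^sub>R w = b"
  using matrix_inv_mult[OF invertible_gram_shift[OF assms, of B]]
  by (metis gram_shift_mult matrix_vector_mul_assoc matrix_vector_mul_lid)

section \<open>Optimality conditions\<close>

text \<open>The subdifferential of the l1-norm. The product condition forces the sign of
  \<open>s $ i\<close> where \<open>v $ i\<close> is nonzero and is vacuous elsewhere; in this form
  closedness and convexity are immediate.\<close>

definition l1_subgradients :: "real ^ 'q \<Rightarrow> (real ^ 'q) set" where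
  "l1_subgradients v = {s. \<forall>i. \<bar>s $ i\<bar> \<le> 1 \<and> s $ i * v $ i = \<bar>v $ i\<bar>}"

text \<open>Fermat's rule: 0 lies in the subdifferential of the objective when \<open>B\<close> is
  \<open>M ** A\<close>.\<close>

definition stationary where
  "stationary B P y lam x \<longleftrightarrow> (\<exists>s\<in>l1_subgradients (P *v x).
     transpose B *v (B *v x - y) + lam *\<^sub>R (transpose P *v s) = 0)"

text \<open>Together with the next lemma: \<open>soft\<close> is the resolvent of \<gamma> times the
  l1 subdifferential, that is, the proximal map of \<gamma> times the l1-norm.\<close>

lemma soft_in_subgradients:
  assumes "\<gamma> > 0"
  shows "(1 / \<gamma>) *\<^sub>R (v - soft v \<gamma>) \<in> l1_subgradients (soft v \<gamma>)"
  using assms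
  by (auto simp: l1_subgradients_def soft_def sgn_if max_def field_simps abs_if)

lemma soft_add_subgradient:
  assumes "\<gamma> > 0" and "s \<in> l1_subgradients v"
  shows "soft (v + \<gamma> *\<^sub>R s) \<gamma> = v"
proof -
  have "sgn (v $ i + \<gamma> * s $ i) * max (\<bar>v $ i + \<gamma> * s $ i\<bar> - \<gamma>) 0 = v $ i" for i
  proof -
    have s: "\<bar>s $ i\<bar> \<le> 1" "s $ i * v $ i = \<bar>v $ i\<bar>"
      using assms(2) by (auto simp: l1_subgradients_def)
    consider "v $ i = 0" | "v $ i > 0" | "v $ i < 0" by linarith
    then show ?thesis
    proof cases
      case 1
      then have "\<gamma> * \<bar>s $ i\<bar> \<le> \<gamma>" using s assms(1) by simp
      with 1 show ?thesis using assms(1) by (simp add: abs_mult)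
    next
      case 2
      then have "s $ i = 1" using s by simp
      with 2 show ?thesis using assms(1) by simp
    next
      case 3
      then have "s $ i = -1" using s using mult_cancel_right[of "s $ i" "v $ i" "-1"] by simp
      with 3 show ?thesis using assms(1) by simp
    qed
  qed
  then show ?thesis by (simp add: soft_def vec_eq_iff)
qed

text \<open>Scalar thresholding is nondecreasing and 1-Lipschitz, so a difference of outputs has the
  sign of the difference of inputs and at most its size.\<close>

lemma soft_firmly_nonexpansive:
  assumes "\<gamma> > 0"
  shows "(soft v \<gamma> - soft w \<gamma>) \<bullet> (soft v \<gamma> - soft w \<gamma>) \<le> (soft v \<gamma> - soft w \<gamma>) \<bullet> (v - w)"
proof -
  have "(a' - b') * (a' - b') \<le> (a' - b') * (a - b)"
    if "a' = sgn a * max (\<bar>a\<bar> - \<gamma>) 0" "b' = sgn b * max (\<bar>b\<bar> - \<gamma>) 0" for a b a' b' :: real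
  proof (cases a' b' rule: linorder_cases)
    case less
    then have "a - b \<le> a' - b'"
      using that assms by (auto simp: sgn_if max_def abs_if split: if_splits)
    with less show ?thesis by (intro mult_left_mono_neg) auto
  next
    case greater
    then have "a' - b' \<le> a - b"
      using that assms by (auto simp: sgn_if max_def abs_if split: if_splits)
    with greater show ?thesis by (intro mult_left_mono) auto
  qed simp
  then show ?thesis
    by (auto simp: inner_vec_def soft_def intro!: sum_mono)
qed

section \<open>Convex calculus of the l1-norm\<close>

lemma l1_norm_subgradient:
  assumes "s \<in> l1_subgradients v"
  shows "l1_norm v + s \<bullet> (w - v) \<le> l1_norm w"
proof -
  have "\<bar>v $ i\<bar> + s $ i * (w $ i - v $ i) \<le> \<bar>w $ i\<bar>" for i
  proof -
    have s: "\<bar>s $ i\<bar> \<le> 1" "s $ i * v $ i = \<bar>v $ i\<bar>"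
      using assms by (auto simp: l1_subgradients_def)
    have "s $ i * w $ i \<le> \<bar>s $ i\<bar> * \<bar>w $ i\<bar>"
      by (metis abs_ge_self abs_mult)
    also have "\<dots> \<le> \<bar>w $ i\<bar>"
      using s(1) by (simp add: mult_left_le_one_le)
    finally show ?thesis using s(2) by (simp add: right_diff_distrib)
  qed
  then show ?thesis
    by (auto simp: l1_norm_def inner_vec_def sum.distrib[symmetric] intro!: sum_mono)
qed

lemma l1_norm_directional_derivative:
  obtains s where "s \<in> l1_subgradients v"
    and "\<forall>\<^sub>F t in at_right 0. l1_norm (v + t *\<^sub>R g) = l1_norm v + t * (s \<bullet> g)"
proof
  \<comment> \<open>For small positive \<open>t\<close> no nonzero component changes sign, so only
    the zero components must follow the direction \<open>g\<close>.\<close>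
  define s where "s = (\<chi> i. if v $ i = 0 then sgn (g $ i) else sgn (v $ i))"
  show "s \<in> l1_subgradients v"
    by (auto simp: s_def l1_subgradients_def sgn_if)
  have "\<forall>\<^sub>F t in at_right 0. \<bar>v $ i + t * g $ i\<bar> = \<bar>v $ i\<bar> + t * (s $ i * g $ i)" for i
  proof -
    have lim: "((\<lambda>t. v $ i + t * g $ i) \<longlongrightarrow> v $ i + 0 * g $ i) (at_right 0)"
      by (intro tendsto_intros)
    consider "v $ i = 0" | "v $ i > 0" | "v $ i < 0" by linarith
    then show ?thesis
    proof cases
      case 1
      then show ?thesis
        using eventually_at_right_less[of "0::real"]
        by (auto elim!: eventually_mono simp: s_def abs_mult abs_sgn sgn_mult mult.commute)
    next
      case 2
      then have "\<forall>\<^sub>F t in at_right 0. v $ i + t * g $ i > 0"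
        using order_tendstoD(1)[OF lim] by simp
      then show ?thesis
        by eventually_elim (use 2 in \<open>simp add: s_def\<close>)
    next
      case 3
      then have "\<forall>\<^sub>F t in at_right 0. v $ i + t * g $ i < 0"
        using order_tendstoD(2)[OF lim] by simp
      then show ?thesis
        by eventually_elim (use 3 in \<open>simp add: s_def\<close>)
    qed
  qed
  then have "\<forall>\<^sub>F t in at_right 0. \<forall>i. \<bar>v $ i + t * g $ i\<bar> = \<bar>v $ i\<bar> + t * (s $ i * g $ i)"
    by (simp add: eventually_all_finite)
  then show "\<forall>\<^sub>F t in at_right 0. l1_norm (v + t *\<^sub>R g) = l1_norm v + t * (s \<bullet> g)"
    by eventually_elim (simp add: l1_norm_def inner_vec_def sum.distrib sum_distrib_left)
qed

text \<open>Compactness survives linear images, which closedness alone need not; the separation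
  argument below relies on this.\<close>

lemma compact_l1_subgradients: "compact (l1_subgradients v)"
proof (rule compact_Int_closed[of "cbox (-1) 1" "l1_subgradients v", THEN back_subst[of compact]])
  show "closed (l1_subgradients v)"
    unfolding l1_subgradients_def
    by (intro closed_Collect_all closed_Collect_conj closed_Collect_le closed_Collect_eq
        continuous_intros)
  show "cbox (-1) 1 \<inter> l1_subgradients v = l1_subgradients v"
    by (auto simp: l1_subgradients_def mem_box_cart abs_le_iff minus_le_iff)
qed simp

lemma convex_l1_subgradients:
  fixes v :: "real ^ 'q"
  shows "convex (l1_subgradients v)"
proof (rule convexI)
  fix s t :: "real ^ 'q" and a b :: real
  assume st: "s \<in> l1_subgradients v" "t \<in> l1_subgradients v" and ab: "0 \<le> a" "0 \<le> b" "a + b = 1"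
  have "\<bar>a * s $ i + b * t $ i\<bar> \<le> 1" for i
    using st ab convex_bound_le[of "\<bar>s $ i\<bar>" 1 "\<bar>t $ i\<bar>" a b] abs_triangle_ineq[of "a * s $ i" "b * t $ i"]
    by (auto simp: l1_subgradients_def abs_mult)
  moreover have "(a * s $ i + b * t $ i) * v $ i = \<bar>v $ i\<bar>" for i
  proof -
    have "(a * s $ i + b * t $ i) * v $ i = a * (s $ i * v $ i) + b * (t $ i * v $ i)"
      by (simp add: algebra_simps)
    also have "\<dots> = (a + b) * \<bar>v $ i\<bar>"
      using st by (simp add: l1_subgradients_def distrib_right)
    finally show ?thesis using ab by simp
  qed
  ultimately show "a *\<^sub>R s + b *\<^sub>R t \<in> l1_subgradients v"
    by (simp add: l1_subgradients_def)
qed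

text \<open>The quadratic part is expanded exactly. Sufficiency of stationarity discards the square
  of \<open>B *v h\<close>; necessity uses that it is of second order.\<close>

lemma analysis_objective_add:
  fixes A :: "real ^ 'n ^ 'n" and M :: "real ^ 'n ^ 'm"
  defines "B \<equiv> M ** A"
  shows "analysis_objective A M P y lam (x + h) =
    analysis_objective A M P y lam x + (transpose B *v (B *v x - y)) \<bullet> h
      + (norm (B *v h))\<^sup>2 / 2 + lam * (l1_norm (P *v x + P *v h) - l1_norm (P *v x))"
  unfolding analysis_objective_def B_def[symmetric] inner_transpose_mult
  by (simp add: matrix_vector_right_distrib power2_norm_eq_inner inner_diff_left inner_diff_right
      inner_add_left inner_add_right inner_commute algebra_simps)

lemma stationary_imp_minimizer:
  assumes "stationary (M ** A) P y lam x" and "lam \<ge> 0"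
  shows "is_arg_min (analysis_objective A M P y lam) (\<lambda>_. True) x"
proof -
  obtain s where s: "s \<in> l1_subgradients (P *v x)"
    and eq: "transpose (M ** A) *v ((M ** A) *v x - y) + lam *\<^sub>R (transpose P *v s) = 0"
    using assms(1) by (auto simp: stationary_def)
  have "analysis_objective A M P y lam x \<le> analysis_objective A M P y lam w" for w
  proof -
    define h where "h = w - x"
    have "lam * (s \<bullet> (P *v h)) \<le> lam * (l1_norm (P *v x + P *v h) - l1_norm (P *v x))"
      using l1_norm_subgradient[OF s, of "P *v x + P *v h"] assms(2) by (intro mult_left_mono) auto
    \<comment> \<open>Stationarity cancels the linear term against the subgradient bound for the l1
      difference, leaving only a square.\<close>
    moreover have "(transpose (M ** A) *v ((M ** A) *v x - y)) \<bullet> h + lam * (s \<bullet> (P *v h)) = 0"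
      using arg_cong[OF eq, of "\<lambda>u. u \<bullet> h"] by (simp add: inner_add_left inner_transpose_mult)
    moreover have "w = x + h" by (simp add: h_def)
    ultimately show ?thesis
      unfolding \<open>w = x + h\<close> using analysis_objective_add[of A M P y lam x h]
        zero_le_power2[of "norm ((M ** A) *v h)"] by linarith
  qed
  then show ?thesis by (simp add: is_arg_min_linorder)
qed

text \<open>
  If the negative gradient of the data term were not in the compact convex set \<open>lam P\<^sup>* s\<close>, \<open>s\<close> an
  \<open>\<ell>\<^sub>1\<close>-subgradient, a separating hyperplane would yield a descent direction.
\<close>

lemma minimizer_imp_stationary:
  assumes min: "\<And>w. analysis_objective A M P y lam x \<le> analysis_objective A M P y lam w"
  shows "stationary (M ** A) P y lam x"
proof (rule ccontr)
  define B where "B = M ** A"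
  define w where "w = - (transpose B *v (B *v x - y))"
  define C where "C = (\<lambda>s. lam *\<^sub>R (transpose P *v s)) ` l1_subgradients (P *v x)"
  have lin: "linear (\<lambda>s. lam *\<^sub>R (transpose P *v s))"
    by (intro linear_compose_scale_right matrix_vector_mul_linear)
  assume "\<not> stationary (M ** A) P y lam x"
  moreover have "transpose B *v (B *v x - y) + w = 0"
    by (simp add: w_def)
  ultimately have wC: "w \<notin> C"
    unfolding stationary_def C_def B_def by auto
  have C: "convex C" "closed C"
    unfolding C_def using lin convex_l1_subgradients compact_l1_subgradients
    by (auto intro!: convex_linear_image compact_imp_closed compact_continuous_image
        linear_continuous_on linear_conv_bounded_linear[THEN iffD1])
  obtain a b where ab: "a \<bullet> w < b" "\<And>c. c \<in> C \<Longrightarrow> a \<bullet> c > b"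
    using separating_hyperplane_closed_point[OF C wC] by metis
  \<comment> \<open>All of \<open>C\<close> lies on the far side of \<open>w\<close> in direction
    \<open>a\<close>, so the slope of the objective along \<open>- a\<close> is negative.\<close>
  define h where "h = - a"
  obtain s where s: "s \<in> l1_subgradients (P *v x)"
    and dir: "\<forall>\<^sub>F t in at_right 0. l1_norm (P *v x + t *\<^sub>R (P *v h)) = l1_norm (P *v x) + t * (s \<bullet> (P *v h))"
    by (rule l1_norm_directional_derivative)
  \<comment> \<open>Minimality makes the increment along \<open>h\<close> nonnegative; after
    division by \<open>t\<close> the quadratic term disappears in the limit, which leaves a
    nonnegative slope.\<close>
  have "\<forall>\<^sub>F t in at_right 0. 0 \<le> (lam * (s \<bullet> (P *v h)) - w \<bullet> h) + t * ((norm (B *v h))\<^sup>2 / 2)"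
    using dir eventually_at_right_less[of "0::real"]
  proof eventually_elim
    case (elim t)
    have "0 \<le> - (w \<bullet> (t *\<^sub>R h)) + (norm (B *v (t *\<^sub>R h)))\<^sup>2 / 2 + lam * (t * (s \<bullet> (P *v h)))"
      using min[of "x + t *\<^sub>R h"] elim analysis_objective_add[of A M P y lam x "t *\<^sub>R h"]
      by (simp add: B_def w_def matrix_vector_mult_scaleR)
    also have "\<dots> = t * ((lam * (s \<bullet> (P *v h)) - w \<bullet> h) + t * ((norm (B *v h))\<^sup>2 / 2))"
      by (simp add: matrix_vector_mult_scaleR power_mult_distrib algebra_simps power2_eq_square)
    finally show ?case using elim by (simp add: zero_le_mult_iff)
  qed
  moreover have "((\<lambda>t. (lam * (s \<bullet> (P *v h)) - w \<bullet> h) + t * ((norm (B *v h))\<^sup>2 / 2))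
      \<longlongrightarrow> (lam * (s \<bullet> (P *v h)) - w \<bullet> h) + 0 * ((norm (B *v h))\<^sup>2 / 2)) (at_right 0)"
    by (intro tendsto_intros)
  ultimately have "0 \<le> lam * (s \<bullet> (P *v h)) - w \<bullet> h"
    using tendsto_lowerbound[of _ _ "at_right (0::real)" 0] by fastforce
  moreover have "a \<bullet> w < a \<bullet> (lam *\<^sub>R (transpose P *v s))"
    using ab s by (fastforce simp: C_def)
  then have "a \<bullet> w < lam * (s \<bullet> (P *v a))"
    by (metis inner_commute inner_scaleR_left inner_transpose_mult)
  ultimately show False
    by (simp add: h_def inner_commute vec.neg)
qed

section \<open>Coercivity and existence of a minimizer\<close>

lemma norm_parseval:
  fixes P :: "real ^ 'n ^ 'q"
  assumes "parseval_analysis P"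
  shows "norm (P *v x) = norm x"
proof -
  have "(P *v x) \<bullet> (P *v x) = (transpose P *v (P *v x)) \<bullet> x"
    by (simp add: inner_transpose_mult)
  also have "\<dots> = x \<bullet> x"
    using assms by (simp add: parseval_analysis_def matrix_vector_mul_assoc)
  finally show ?thesis by (simp add: norm_eq_sqrt_inner)
qed

lemma analysis_objective_attains_min:
  fixes P :: "real ^ 'n ^ 'q"
  assumes "lam > 0" and "parseval_analysis P"
  obtains x where "\<And>w. analysis_objective A M P y lam x \<le> analysis_objective A M P y lam w"
proof -
  let ?F = "analysis_objective A M P y lam"
  have lower: "lam * norm w \<le> ?F w" for w
  proof -
    have "norm w \<le> l1_norm (P *v w)"
      using norm_le_l1_cart[of "P *v w"] norm_parseval[OF assms(2), of w] by (simp add: l1_norm_def)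
    then show ?thesis
      using assms(1) by (simp add: analysis_objective_def add_increasing)
  qed
  have cont: "continuous_on S ?F" for S
    unfolding analysis_objective_def l1_norm_def
    by (intro continuous_intros matrix_vector_mult_linear_continuous_on)
  \<comment> \<open>Beyond this radius the lower bound exceeds the value at 0, so a minimizer over
    the ball is global.\<close>
  define R where "R = ?F 0 / lam"
  have "R \<ge> 0" using lower[of 0] assms(1) by (simp add: R_def)
  then obtain x where x: "x \<in> cball 0 R" "\<And>w. w \<in> cball 0 R \<Longrightarrow> ?F x \<le> ?F w"
    using continuous_attains_inf[OF compact_cball _ cont, of 0 R] by auto
  have "?F x \<le> ?F w" for w
  proof (cases "norm w \<le> R")
    case False
    then have "?F 0 \<le> lam * norm w"
      using assms(1) by (simp add: R_def field_simps)
    then show ?thesis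
      using lower[of w] x(2)[of 0] \<open>R \<ge> 0\<close> by simp
  qed (use x in auto)
  then show ?thesis by (rule that)
qed

section \<open>The Douglas--Rachford operator\<close>

text \<open>For positive \<mu> this is the minimizer over \<open>u\<close> of half the squared norm
  of \<open>y - M *v u\<close> plus \<mu>/2 times the squared distance of \<open>u\<close> to
  \<open>v\<close>.\<close>

definition mask_prox :: "real ^ 'n ^ 'm \<Rightarrow> real ^ 'm \<Rightarrow> real \<Rightarrow> real ^ 'n \<Rightarrow> real ^ 'n" where
  "mask_prox M y \<mu> v =
     matrix_inv (transpose M ** M + \<mu> *\<^sub>R mat 1) *v (transpose M *v y + \<mu> *\<^sub>R v)"

text \<open>For a Parseval \<open>P\<close> and positive \<rho> this minimizes \<open>(norm (A *v w
  - a))\<^sup>2 + \<rho> * (norm (P *v w - b))\<^sup>2\<close> over \<open>w\<close>, since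
  \<open>transpose P ** P\<close> is the identity.\<close>

definition ls_fit ::
  "real ^ 'n ^ 'n \<Rightarrow> real ^ 'n ^ 'q \<Rightarrow> real \<Rightarrow> real ^ 'n \<Rightarrow> real ^ 'q \<Rightarrow> real ^ 'n" where
  "ls_fit A P \<rho> a b =
     matrix_inv (transpose A ** A + \<rho> *\<^sub>R mat 1) *v (transpose A *v a + \<rho> *\<^sub>R (transpose P *v b))"

locale fa_md =
  fixes A :: "real ^ 'n::finite ^ 'n"
    and M :: "real ^ 'n ^ 'm::finite"
    and P :: "real ^ 'n ^ 'q::finite"
    and y :: "real ^ 'm"
    and lam \<mu>1 \<mu>2 :: real
  assumes lam: "lam > 0" and mu1: "\<mu>1 > 0" and mu2: "\<mu>2 > 0"
    and parseval: "parseval_analysis P"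
begin

definition shrink where "shrink v = soft v (lam / \<mu>2)"

text \<open>The arguments are the reflections (twice the proximal map minus the identity) of
  Douglas-Rachford. The projection is recorded by its preimage \<open>w\<close>, because that is the
  algorithm's \<open>z\<close>.\<close>

definition fit where
  "fit x = ls_fit A P (\<mu>2 / \<mu>1) (2 *\<^sub>R mask_prox M y \<mu>1 (fst x) - fst x) (2 *\<^sub>R shrink (snd x) - snd x)"

definition dr_step where
  "dr_step x = (fst x + (A *v fit x - mask_prox M y \<mu>1 (fst x)), snd x + (P *v fit x - shrink (snd x)))"

definition sqnorm :: "(real ^ 'n) \<times> (real ^ 'q) \<Rightarrow> real" where
  "sqnorm v = \<mu>1 * (fst v \<bullet> fst v) + \<mu>2 * (snd v \<bullet> snd v)"

lemma mask_prox_iff: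
  "mask_prox M y \<mu>1 v = u \<longleftrightarrow> transpose M *v (M *v u - y) = \<mu>1 *\<^sub>R (v - u)"
  unfolding mask_prox_def matrix_inv_gram_shift_iff[OF mu1]
  by (auto simp: matrix_vector_mult_diff_distrib algebra_simps)

text \<open>The residual is orthogonal to the range of \<open>w \<mapsto> (A w, P w)\<close> in the
  weighted inner product. Parseval lets a bare \<open>w\<close> be read as
  \<open>transpose P *v (P *v w)\<close>.\<close>

lemma ls_fit_iff:
  "ls_fit A P (\<mu>2 / \<mu>1) a b = w \<longleftrightarrow>
    \<mu>1 *\<^sub>R (transpose A *v (A *v w - a)) + \<mu>2 *\<^sub>R (transpose P *v (P *v w - b)) = 0"
proof -
  have PP: "transpose P *v (P *v w) = w"
    using parseval by (simp add: parseval_analysis_def matrix_vector_mul_assoc)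
  have "ls_fit A P (\<mu>2 / \<mu>1) a b = w \<longleftrightarrow>
      transpose A *v (A *v w) + (\<mu>2 / \<mu>1) *\<^sub>R w = transpose A *v a + (\<mu>2 / \<mu>1) *\<^sub>R (transpose P *v b)"
    using mu1 mu2 by (simp add: ls_fit_def matrix_inv_gram_shift_iff)
  also have "\<dots> \<longleftrightarrow> \<mu>1 *\<^sub>R (transpose A *v (A *v w) + (\<mu>2 / \<mu>1) *\<^sub>R w)
      = \<mu>1 *\<^sub>R (transpose A *v a + (\<mu>2 / \<mu>1) *\<^sub>R (transpose P *v b))"
    using mu1 by simp
  also have "\<dots> \<longleftrightarrow> \<mu>1 *\<^sub>R (transpose A *v (A *v w - a)) + \<mu>2 *\<^sub>R (transpose P *v (P *v w - b)) = 0"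
    using mu1 by (simp add: matrix_vector_mult_diff_distrib PP scaleR_add_right scaleR_diff_right)
      (auto simp: algebra_simps)
  finally show ?thesis .
qed

text \<open>Subtracting the two normal equations and pairing with \<open>e\<close> gives
  \<open>\<mu>1 * ((v - w - e) \<bullet> e)\<close> as the squared norm of
  \<open>M *v e\<close>.\<close>

lemma mask_prox_firmly_nonexpansive:
  fixes v w
  defines "e \<equiv> mask_prox M y \<mu>1 v - mask_prox M y \<mu>1 w"
  shows "e \<bullet> e \<le> e \<bullet> (v - w)"
proof -
  define u t where "u = mask_prox M y \<mu>1 v" and "t = mask_prox M y \<mu>1 w"
  have u: "transpose M *v (M *v u - y) = \<mu>1 *\<^sub>R (v - u)"
    and t: "transpose M *v (M *v t - y) = \<mu>1 *\<^sub>R (w - t)"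
    using mask_prox_iff u_def t_def by blast+
  have "transpose M *v (M *v (u - t)) = transpose M *v (M *v u - y) - transpose M *v (M *v t - y)"
    by (simp add: matrix_vector_mult_diff_distrib)
  also have "\<dots> = \<mu>1 *\<^sub>R ((v - w) - (u - t))"
    unfolding u t by (simp add: algebra_simps)
  finally have "(M *v (u - t)) \<bullet> (M *v (u - t)) = \<mu>1 * (((v - w) - (u - t)) \<bullet> (u - t))"
    by (metis inner_scaleR_left inner_transpose_mult)
  then have "0 \<le> \<mu>1 * (((v - w) - (u - t)) \<bullet> (u - t))"
    by (metis inner_ge_zero)
  then have "0 \<le> ((v - w) - (u - t)) \<bullet> (u - t)"
    using mu1 by (simp add: zero_le_mult_iff)
  then show ?thesis
    by (simp add: e_def u_def t_def inner_diff_left inner_diff_right inner_commute)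
qed

lemma shrink_firmly_nonexpansive:
  "(shrink v - shrink w) \<bullet> (shrink v - shrink w) \<le> (shrink v - shrink w) \<bullet> (v - w)"
  unfolding shrink_def using lam mu2 by (intro soft_firmly_nonexpansive) simp

text \<open>The difference of the two sides is twice a weighted sum of two contributions: one
  vanishes by orthogonality of the projection residual, the other is nonpositive by firm
  nonexpansiveness.\<close>

lemma sqnorm_dr_step_le:
  assumes p: "dr_step p = p"
  shows "sqnorm (dr_step x - p) \<le> sqnorm (x - p) - sqnorm (dr_step x - x)"
proof -
  define w where "w = fit x - fit p"
  define e1 e2 where "e1 = mask_prox M y \<mu>1 (fst x) - mask_prox M y \<mu>1 (fst p)"
    and "e2 = shrink (snd x) - shrink (snd p)"
  define c1 c2 where "c1 = fst x - fst p" and "c2 = snd x - snd p"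
  \<comment> \<open>At a fixed point projection and proximal map agree, so the step
    \<open>dr_step x - x\<close> is expressed by differences between \<open>x\<close> and
    \<open>p\<close>.\<close>
  have fixp: "A *v fit p = mask_prox M y \<mu>1 (fst p)" "P *v fit p = shrink (snd p)"
    using p by (auto simp: dr_step_def prod_eq_iff)
  have normal: "\<mu>1 *\<^sub>R (transpose A *v (A *v fit v - (2 *\<^sub>R mask_prox M y \<mu>1 (fst v) - fst v)))
      + \<mu>2 *\<^sub>R (transpose P *v (P *v fit v - (2 *\<^sub>R shrink (snd v) - snd v))) = 0" for v
    by (rule iffD1[OF ls_fit_iff fit_def[symmetric]])
  have normalw: "\<mu>1 *\<^sub>R (transpose A *v (A *v w - 2 *\<^sub>R e1 + c1))
      + \<mu>2 *\<^sub>R (transpose P *v (P *v w - 2 *\<^sub>R e2 + c2)) = 0"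
  proof -
    define a1 a2 where "a1 v = A *v fit v - (2 *\<^sub>R mask_prox M y \<mu>1 (fst v) - fst v)"
      and "a2 v = P *v fit v - (2 *\<^sub>R shrink (snd v) - snd v)" for v
    have "A *v w - 2 *\<^sub>R e1 + c1 = a1 x - a1 p" "P *v w - 2 *\<^sub>R e2 + c2 = a2 x - a2 p"
      by (simp_all add: a1_def a2_def w_def e1_def e2_def c1_def c2_def
          matrix_vector_mult_diff_distrib scaleR_diff_right)
    then have "\<mu>1 *\<^sub>R (transpose A *v (A *v w - 2 *\<^sub>R e1 + c1))
        + \<mu>2 *\<^sub>R (transpose P *v (P *v w - 2 *\<^sub>R e2 + c2))
      = (\<mu>1 *\<^sub>R (transpose A *v a1 x) + \<mu>2 *\<^sub>R (transpose P *v a2 x))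
        - (\<mu>1 *\<^sub>R (transpose A *v a1 p) + \<mu>2 *\<^sub>R (transpose P *v a2 p))"
      by (simp add: matrix_vector_mult_diff_distrib scaleR_diff_right)
    also have "\<dots> = 0"
      using normal[of x] normal[of p] unfolding a1_def a2_def by simp
    finally show ?thesis .
  qed
  have orth: "\<mu>1 * ((A *v w - 2 *\<^sub>R e1 + c1) \<bullet> (A *v w)) + \<mu>2 * ((P *v w - 2 *\<^sub>R e2 + c2) \<bullet> (P *v w)) = 0"
    using arg_cong[OF normalw, of "\<lambda>v. v \<bullet> w"]
    by (simp only: inner_add_left[of "\<mu>1 *\<^sub>R _"] inner_scaleR_left inner_transpose_mult inner_zero_left)
  define r1 r2 where "r1 = A *v w" and "r2 = P *v w"
  have firm: "\<mu>1 * (e1 \<bullet> e1 - e1 \<bullet> c1) \<le> 0" "\<mu>2 * (e2 \<bullet> e2 - e2 \<bullet> c2) \<le> 0"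
    using mask_prox_firmly_nonexpansive shrink_firmly_nonexpansive mu1 mu2
    by (auto simp: e1_def e2_def c1_def c2_def intro!: mult_nonneg_nonpos)
  \<comment> \<open>The identity in one component: \<open>c\<close> is the difference of points,
    \<open>r\<close> of projections, \<open>e\<close> of proximal values.\<close>
  have polar: "(c + (r - e)) \<bullet> (c + (r - e)) - (c \<bullet> c - (r - e) \<bullet> (r - e))
      = 2 * ((r - 2 *\<^sub>R e + c) \<bullet> r + (e \<bullet> e - e \<bullet> c))" for c r e :: "real ^ 'k"
    by (simp add: inner_add_left inner_add_right inner_diff_left inner_diff_right
        inner_commute[of r e] inner_commute[of r c] inner_commute[of e c])
  have "dr_step x - p = (c1 + (r1 - e1), c2 + (r2 - e2))" "dr_step x - x = (r1 - e1, r2 - e2)"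
    "x - p = (c1, c2)"
    by (simp_all add: dr_step_def prod_eq_iff c1_def c2_def r1_def r2_def e1_def e2_def w_def
        matrix_vector_mult_diff_distrib fixp)
  then have "sqnorm (dr_step x - p) - (sqnorm (x - p) - sqnorm (dr_step x - x))
      = \<mu>1 * ((c1 + (r1 - e1)) \<bullet> (c1 + (r1 - e1)) - (c1 \<bullet> c1 - (r1 - e1) \<bullet> (r1 - e1)))
        + \<mu>2 * ((c2 + (r2 - e2)) \<bullet> (c2 + (r2 - e2)) - (c2 \<bullet> c2 - (r2 - e2) \<bullet> (r2 - e2)))"
    by (simp add: sqnorm_def right_diff_distrib)
  also have "\<dots> = 2 * ((\<mu>1 * ((r1 - 2 *\<^sub>R e1 + c1) \<bullet> r1) + \<mu>2 * ((r2 - 2 *\<^sub>R e2 + c2) \<bullet> r2))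
        + \<mu>1 * (e1 \<bullet> e1 - e1 \<bullet> c1) + \<mu>2 * (e2 \<bullet> e2 - e2 \<bullet> c2))"
    unfolding polar by (simp only: distrib_left mult.left_commute[of _ 2] add_ac)
  also have "\<dots> \<le> 0"
    using orth firm by (simp add: r1_def r2_def)
  finally show ?thesis by simp
qed

section \<open>Fixed points and stationary points\<close>

lemma dr_step_fixpoint_imp_stationary:
  assumes "dr_step x = x"
  shows "stationary (M ** A) P y lam (fit x)"
proof -
  \<comment> \<open>The scaled thresholding residual is a subgradient at the thresholded point,
    which for a fixed point is \<open>P *v fit x\<close>.\<close>
  define s where "s = (1 / (lam / \<mu>2)) *\<^sub>R (snd x - shrink (snd x))"
  have fixp: "mask_prox M y \<mu>1 (fst x) = A *v fit x" "shrink (snd x) = P *v fit x"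
    using assms by (auto simp: dr_step_def prod_eq_iff)
  have s: "s \<in> l1_subgradients (P *v fit x)"
    using soft_in_subgradients[of "lam / \<mu>2" "snd x"] lam mu2 fixp
    by (simp add: s_def shrink_def)
  have lams: "lam *\<^sub>R s = \<mu>2 *\<^sub>R (snd x - P *v fit x)"
    using lam by (simp add: s_def fixp)
  have mask: "transpose M *v (M *v (A *v fit x) - y) = \<mu>1 *\<^sub>R (fst x - A *v fit x)"
    using fixp(1) by (simp add: mask_prox_iff)
  have "\<mu>1 *\<^sub>R (transpose A *v (A *v fit x - (2 *\<^sub>R (A *v fit x) - fst x)))
      + \<mu>2 *\<^sub>R (transpose P *v (P *v fit x - (2 *\<^sub>R (P *v fit x) - snd x))) = 0"
    by (rule iffD1[OF ls_fit_iff fit_def[of x, unfolded fixp, symmetric]])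
  then have "\<mu>1 *\<^sub>R (transpose A *v (fst x - A *v fit x)) + \<mu>2 *\<^sub>R (transpose P *v (snd x - P *v fit x)) = 0"
    by (simp add: scaleR_2 algebra_simps)
  then have "transpose A *v (transpose M *v (M *v (A *v fit x) - y)) + lam *\<^sub>R (transpose P *v s) = 0"
    unfolding mask by (metis lams matrix_vector_mult_scaleR)
  then show ?thesis
    unfolding stationary_def using s
    by (intro bexI[of _ s]) (simp_all add: matrix_transpose_mul matrix_vector_mul_assoc[symmetric])
qed

lemma stationary_imp_dr_step_fixpoint:
  assumes "stationary (M ** A) P y lam w"
  obtains x where "dr_step x = x"
proof -
  obtain s where s: "s \<in> l1_subgradients (P *v w)"
    and eq: "transpose A *v (transpose M *v (M *v (A *v w) - y)) + lam *\<^sub>R (transpose P *v s) = 0"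
    using assms
    by (auto simp: stationary_def matrix_transpose_mul matrix_vector_mul_assoc[symmetric])
  define g where "g = transpose M *v (M *v (A *v w) - y)"
  \<comment> \<open>Inverts the proximal maps: each component is the desired output plus the scaled
    (sub)gradient there.\<close>
  define x where "x = (A *v w + (1 / \<mu>1) *\<^sub>R g, P *v w + (lam / \<mu>2) *\<^sub>R s)"
  have u1: "mask_prox M y \<mu>1 (fst x) = A *v w"
    using mu1 by (simp add: mask_prox_iff x_def g_def)
  have u2: "shrink (snd x) = P *v w"
    using soft_add_subgradient[OF _ s, of "lam / \<mu>2"] lam mu2 by (simp add: shrink_def x_def)
  have "\<mu>1 *\<^sub>R (transpose A *v (A *v w - (2 *\<^sub>R (A *v w) - fst x)))
      + \<mu>2 *\<^sub>R (transpose P *v (P *v w - (2 *\<^sub>R (P *v w) - snd x))) =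
      transpose A *v g + lam *\<^sub>R (transpose P *v s)"
    using mu1 mu2 by (simp add: x_def scaleR_2 matrix_vector_mult_scaleR)
  then have "fit x = w"
    unfolding fit_def u1 u2 ls_fit_iff using eq by (simp add: g_def)
  then have "dr_step x = x"
    by (simp add: dr_step_def u1 u2)
  then show ?thesis by (rule that)
qed

section \<open>Continuity and convergence\<close>

lemma continuous_on_shrink: "continuous_on S (\<lambda>x. shrink (snd x))"
proof -
  \<comment> \<open>Firm nonexpansiveness and Cauchy-Schwarz, followed by cancelling one
    factor.\<close>
  have "norm (shrink v - shrink w) \<le> norm (v - w)" for v w
  proof (cases "shrink v = shrink w")
    case False
    have "norm (shrink v - shrink w) * norm (shrink v - shrink w) \<le> norm (shrink v - shrink w) * norm (v - w)"
      using shrink_firmly_nonexpansive[of v w] norm_cauchy_schwarz[of "shrink v - shrink w" "v - w"]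
      by (simp add: power2_norm_eq_inner[symmetric] power2_eq_square)
    with False show ?thesis by simp
  qed simp
  then have "1-lipschitz_on UNIV shrink"
    by (intro lipschitz_onI) (simp_all add: dist_norm)
  then have "continuous_on UNIV shrink"
    by (rule lipschitz_on_continuous_on)
  then show ?thesis
    by (rule continuous_on_compose2) (auto intro: continuous_intros)
qed

lemma continuous_on_fit: "continuous_on S fit"
  unfolding fit_def ls_fit_def mask_prox_def
  by (intro continuous_intros continuous_on_shrink matrix_vector_mult_linear_continuous_on
      bounded_linear.continuous_on[OF matrix_vector_mul_bounded_linear])

lemma continuous_on_dr_step: "continuous_on S dr_step"
  unfolding dr_step_def mask_prox_def
  by (intro continuous_intros continuous_on_shrink continuous_on_fit
      bounded_linear.continuous_on[OF matrix_vector_mul_bounded_linear])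

lemma dr_iteration_converges:
  assumes "\<And>k. x (Suc k) = dr_step (x k)"
  obtains l where "dr_step l = l" and "x \<longlonglongrightarrow> l"
proof -
  obtain w where "\<And>v. analysis_objective A M P y lam w \<le> analysis_objective A M P y lam v"
    using analysis_objective_attains_min[OF lam parseval] by blast
  then obtain p where p: "dr_step p = p"
    by (rule stationary_imp_dr_step_fixpoint[OF minimizer_imp_stationary])
  have "continuous_on UNIV sqnorm"
    unfolding sqnorm_def by (intro continuous_intros)
  moreover have "min \<mu>1 \<mu>2 * (norm v)\<^sup>2 \<le> sqnorm v" for v
  proof -
    have "(norm v)\<^sup>2 = fst v \<bullet> fst v + snd v \<bullet> snd v"
      by (simp add: power2_norm_eq_inner inner_prod_def)
    then show ?thesis
      by (simp add: sqnorm_def distrib_left add_mono mult_right_mono)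
  qed
  moreover have "sqnorm 0 = 0" and "min \<mu>1 \<mu>2 > 0"
    using mu1 mu2 by (simp_all add: sqnorm_def)
  ultimately show ?thesis
    using fejer_iteration_converges[where x = x and T = dr_step and \<Phi> = sqnorm and p = p]
      assms continuous_on_dr_step sqnorm_dr_step_le p that
    by metis
qed

lemma fa_md_converges:
  assumes "fa_md_iterates A M P y lam \<mu>1 \<mu>2 z u1 d1 u2 d2"
  obtains x where "stationary (M ** A) P y lam x" and "z \<longlonglongrightarrow> x"
proof -
  \<comment> \<open>These are the inputs of the proximal maps. Each new \<open>d\<close> is
    \<open>u\<close> minus this input, so \<open>u + d\<close> is the reflection required by
    \<open>fit\<close>.\<close>
  define x where "x k = (A *v z (Suc k) - d1 k, P *v z (Suc k) - d2 k)" for k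
  have z: "z (Suc k) = ls_fit A P (\<mu>2 / \<mu>1) (u1 k + d1 k) (u2 k + d2 k)"
    and u1: "u1 (Suc k) = mask_prox M y \<mu>1 (fst (x k))"
    and u2: "u2 (Suc k) = shrink (snd (x k))"
    and d1: "d1 (Suc k) = u1 (Suc k) - fst (x k)"
    and d2: "d2 (Suc k) = u2 (Suc k) - snd (x k)" for k
    using assms unfolding fa_md_iterates_def
    by (simp_all add: ls_fit_def mask_prox_def x_def shrink_def)
  have fit: "z (Suc (Suc k)) = fit (x k)" for k
    unfolding z[of "Suc k"] d1 d2 u1 u2 fit_def by (simp add: scaleR_2 algebra_simps)
  have "x (Suc k) = dr_step (x k)" for k
  proof -
    have "x (Suc k) = (A *v fit (x k) - d1 (Suc k), P *v fit (x k) - d2 (Suc k))"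
      by (simp add: x_def fit)
    then show ?thesis
      by (simp add: dr_step_def d1 d2 u1 u2)
  qed
  then obtain l where l: "dr_step l = l" "x \<longlonglongrightarrow> l"
    by (rule dr_iteration_converges)
  \<comment> \<open>The shift is by two because the arbitrary initial \<open>u\<close> and
    \<open>d\<close> need not form a reflection; \<open>z (Suc 0)\<close> only feeds into
    \<open>x 0\<close>.\<close>
  have "(\<lambda>k. z (Suc (Suc k))) \<longlonglongrightarrow> fit l"
    unfolding fit using continuous_on_tendsto_compose[OF continuous_on_fit[of UNIV] l(2)] by simp
  then have "(\<lambda>k. z (Suc k)) \<longlonglongrightarrow> fit l"
    by (rule LIMSEQ_imp_Suc)
  then have "z \<longlonglongrightarrow> fit l"
    by (rule LIMSEQ_imp_Suc)
  with dr_step_fixpoint_imp_stationary[OF l(1)] show ?thesis by (rule that)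
qed

end

theorem proposition6:
  fixes A :: "real ^ 'n::finite ^ 'n"
    and M :: "real ^ 'n ^ 'm::finite"
    and P :: "real ^ 'n ^ 'q::finite"
    and y :: "real ^ 'm"
    and lam \<mu>1 \<mu>2 :: real
    and N1 N2 :: nat
    and pix :: "'n \<Rightarrow> nat \<times> nat"
    and z u1 d1 :: "nat \<Rightarrow> real ^ 'n"
    and u2 d2 :: "nat \<Rightarrow> real ^ 'q"
  assumes "bij_betw pix UNIV ({..<N1} \<times> {..<N2})"
    and "CARD('m) < CARD('n)"
    and "CARD('q) \<ge> CARD('n)"
    and "lam > 0"
    and "periodic_convolution N1 N2 pix A"
    and "masking_matrix M"
    and "parseval_analysis P"
    and "\<mu>1 > 0" and "\<mu>2 > 0"
    and "fa_md_iterates A M P y lam \<mu>1 \<mu>2 z u1 d1 u2 d2"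
  shows "\<exists>x. is_arg_min (analysis_objective A M P y lam) (\<lambda>_. True) x \<and> z \<longlonglongrightarrow> x"
proof -
  interpret fa_md A M P y lam \<mu>1 \<mu>2
    using assms by unfold_locales auto
  obtain x where "stationary (M ** A) P y lam x" and "z \<longlonglongrightarrow> x"
    using assms by (blast intro: fa_md_converges)
  then show ?thesis
    using stationary_imp_minimizer assms(4) by (blast intro: less_imp_le)
qed

end
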